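(* There exists a stable set $S \subseteq \mathbb{N}$ with natural density $d(S) = \frac{1}{2}$ (in particular $S$ has positive lower density) such that \[ S \cap (S+1) \cap (S+2) = \emptyset . \]
   Context: For $A \subseteq \mathbb{N}$, the natural density is $d(A) = \lim_{x\to\infty} \frac{|A \cap [1,x]|}{x}$ when the limit exists; the lower density $\underline{d}(A)$ is the corresponding $\liminf$. For $h \in \mathbb{Z}$, $S + h = \{ s + h : s \in S\}$. A set $S \subseteq \mathbb{N}$ is called stable if for every prime $p$, \[ d\big(\{ n \in \mathbb{N} : \mathbb{1}_{n \in S} \neq \mathbb{1}_{pn \in S} \}\big) = 0, \] i.e. for every prime $p$, $n \in S$ if and only if $pn \in S$ for all $n$ outside a set of density $0$. *)

theory Defs
  imports "HOL-Analysis.Analysis" "HOL-Computational_Algebra.Primes"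
begin

text \<open>
  The natural numbers of the source start at 1. The interval \<open>[1, x]\<close> below excludes
  the element 0 of type \<^typ>\<open>nat\<close>, and \<open>x\<close> ranges over the reals.
\<close>

definition counting_ratio :: "nat set \<Rightarrow> real \<Rightarrow> real" where
  "counting_ratio A x = real (card (A \<inter> {n. 1 \<le> n \<and> real n \<le> x})) / x"

definition has_natural_density :: "nat set \<Rightarrow> real \<Rightarrow> bool" where
  "has_natural_density A d \<longleftrightarrow> (counting_ratio A \<longlongrightarrow> d) at_top"

definition lower_density :: "nat set \<Rightarrow> ereal" where
  "lower_density A = Liminf at_top (\<lambda>x. ereal (counting_ratio A x))"

definition stable :: "nat set \<Rightarrow> bool" where
  "stable S \<longleftrightarrow> S \<subseteq> {1..} \<and>
     (\<forall>p. prime p \<longrightarrow> has_natural_density {n. 1 \<le> n \<and> (n \<in> S) \<noteq> (p * n \<in> S)} 0)"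

end

theory Submission
  imports Defs "HOL-Library.Discrete_Functions" "HOL-Real_Asymp.Real_Asymp"
begin

text \<open>
  Let \<open>\<chi>\<close> be the nonprincipal character modulo 3, extended to multiples of 3 by \<open>\<chi>(3n) = \<chi>(n)\<close>.
  Among three consecutive integers \<open>\<chi>\<close> takes both signs. If \<open>\<psi>\<close> is a sign that satisfies
  \<open>\<psi>(n + 1) = \<psi>(n)\<close> and \<open>\<psi>(pn) = \<chi>(p) \<psi>(n)\<close> off sets of density 0, then \<open>S = {n. \<chi>(n) \<psi>(n) = -1}\<close>
  is stable, contains three consecutive integers only on a set of density 0, which can be deleted,
  and has density 1/2: it contains half of the non-multiples of 3, and \<open>3n \<in> S \<longleftrightarrow> n \<in> S\<close>
  off a set of density 0.

  To find \<open>\<psi>\<close>, note that Kronecker's theorem gives frequencies \<open>a\<close> for which \<open>a ln p\<close> is close to an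
  integer of the parity prescribed by \<open>\<chi>(p)\<close> for all small primes \<open>p\<close>; then
  \<open>\<psi>(n) = (-1)^\<lfloor>a ln n\<rfloor>\<close> is correct off a set of small upper density. Better and better frequencies
  cannot be substituted abruptly at some point \<open>N\<close>, since this would spoil \<open>n \<in> [N/p, N]\<close>. Instead
  one passes from \<open>a\<close> to \<open>b\<close> in many small steps, using \<open>b\<close> at those \<open>n\<close> where the fractional part of
  \<open>a ln n\<close> is below a threshold \<open>c\<close> that increases from 0 to 1. These sets are themselves almost
  invariant under multiplication by small primes.
\<close>

section \<open>Sets of small upper density\<close>

text \<open>An eventual inequality stands in for the upper density: \<open>rare e P\<close> gives
  upper density at most \<open>e\<close>, and upper density below \<open>e\<close> gives
  \<open>rare e P\<close>. Errors can thus be added without any limsup.\<close>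

definition rare :: "real \<Rightarrow> (nat \<Rightarrow> bool) \<Rightarrow> bool" where
  "rare e P \<longleftrightarrow> (\<forall>\<^sub>F x in sequentially. real (card {n\<in>{1..x}. P n}) \<le> e * real x)"

definition negligible_pred :: "(nat \<Rightarrow> bool) \<Rightarrow> bool" where
  "negligible_pred P \<longleftrightarrow> (\<forall>e>0. rare e P)"

lemma rare_mono:
  assumes "rare e Q" "\<And>n. n \<ge> 1 \<Longrightarrow> P n \<Longrightarrow> Q n" "e \<le> f"
  shows "rare f P"
  using assms(1) unfolding rare_def
proof eventually_elim
  case (elim x)
  have "card {n\<in>{1..x}. P n} \<le> card {n\<in>{1..x}. Q n}"
    using assms(2) by (intro card_mono) auto
  also have "real (card {n\<in>{1..x}. Q n}) \<le> f * real x"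
    using elim mult_right_mono[OF assms(3), of "real x"] by simp
  finally show ?case by simp
qed

lemma rare_disj:
  assumes "rare e P" "rare f Q"
  shows "rare (e + f) (\<lambda>n. P n \<or> Q n)"
  using assms unfolding rare_def
proof eventually_elim
  case (elim x)
  have "{n\<in>{1..x}. P n \<or> Q n} = {n\<in>{1..x}. P n} \<union> {n\<in>{1..x}. Q n}"
    by auto
  then have "card {n\<in>{1..x}. P n \<or> Q n} \<le> card {n\<in>{1..x}. P n} + card {n\<in>{1..x}. Q n}"
    by (simp add: card_Un_le)
  then show ?case
    using elim by (simp add: distrib_right)
qed

lemma rare_one: "e \<ge> 1 \<Longrightarrow> rare e P"
  unfolding rare_def
proof (intro always_eventually allI)
  fix x assume e: "e \<ge> 1"
  have "card {n\<in>{1..x}. P n} \<le> card {1..x}"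
    by (intro card_mono) auto
  also have "real (card {1..x}) \<le> e * real x"
    using mult_right_mono[OF e, of "real x"] by simp
  finally show "real (card {n\<in>{1..x}. P n}) \<le> e * real x" by simp
qed

text \<open>Finitely many exceptions cost a constant, absorbed by \<open>(f - e) * x\<close>; hence
  the strict \<open>e < f\<close>.\<close>

lemma rare_eventually_mono:
  assumes "rare e Q" "\<forall>\<^sub>F n in sequentially. P n \<longrightarrow> Q n" "e < f"
  shows "rare f P"
proof -
  obtain N where N: "\<And>n. n \<ge> N \<Longrightarrow> P n \<Longrightarrow> Q n"
    using assms(2) by (auto simp: eventually_sequentially)
  have "\<forall>\<^sub>F x in sequentially. real N \<le> (f - e) * real x"
    using assms(3) by real_asymp
  with assms(1) show ?thesis
    unfolding rare_def
  proof eventually_elim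
    case (elim x)
    have "{n\<in>{1..x}. P n} \<subseteq> {..<N} \<union> {n\<in>{1..x}. Q n}"
      using N by force
    then have "card {n\<in>{1..x}. P n} \<le> card ({..<N} \<union> {n\<in>{1..x}. Q n})"
      by (intro card_mono) auto
    also have "\<dots> \<le> N + card {n\<in>{1..x}. Q n}"
      using card_Un_le[of "{..<N}"] by simp
    finally show ?case
      using elim by (simp add: algebra_simps)
  qed
qed

text \<open>\<open>g\<close> injects the counted \<open>n\<close> up to \<open>x\<close> into points
  of \<open>P\<close> up to \<open>B * x\<close>, so the density grows at most by the factor
  \<open>B\<close>.\<close>

lemma rare_comp:
  fixes g :: "nat \<Rightarrow> nat"
  assumes "rare e P" "inj_on g {1..}" "\<And>n. n \<ge> 1 \<Longrightarrow> 1 \<le> g n \<and> g n \<le> B * n" "B > 0"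
  shows "rare (e * real B) (\<lambda>n. P (g n))"
proof -
  have "filterlim (\<lambda>x. B * x) sequentially sequentially"
    by (rule filterlim_at_top_mono[OF filterlim_ident]) (use assms(4) in \<open>auto intro!: always_eventually\<close>)
  with assms(1) have "\<forall>\<^sub>F x in sequentially. real (card {n\<in>{1..B * x}. P n}) \<le> e * real (B * x)"
    unfolding rare_def by (rule eventually_compose_filterlim)
  then show ?thesis
    unfolding rare_def
  proof eventually_elim
    case (elim x)
    have "g ` {n\<in>{1..x}. P (g n)} \<subseteq> {n\<in>{1..B * x}. P n}"
    proof safe
      fix n assume "n \<in> {1..x}"
      then have "1 \<le> g n" "g n \<le> B * n" "B * n \<le> B * x"
        using assms(3)[of n] by auto
      then show "g n \<in> {1..B * x}" unfolding atLeastAtMost_iff by linarith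
    qed
    then have "card {n\<in>{1..x}. P (g n)} \<le> card {n\<in>{1..B * x}. P n}"
      by (intro card_inj_on_le[of g]) (auto intro: inj_on_subset[OF assms(2)])
    with elim show ?case by (simp add: mult.assoc)
  qed
qed

lemma negligible_pred_mono:
  assumes "negligible_pred Q" "\<And>n. n \<ge> 1 \<Longrightarrow> P n \<Longrightarrow> Q n"
  shows "negligible_pred P"
  using assms unfolding negligible_pred_def by (blast intro: rare_mono[where Q = Q])

lemma negligible_pred_disj:
  assumes "negligible_pred P" "negligible_pred Q"
  shows "negligible_pred (\<lambda>n. P n \<or> Q n)"
  unfolding negligible_pred_def
proof safe
  fix e :: real assume "e > 0"
  then have "rare (e/2) P" "rare (e/2) Q"
    using assms by (simp_all add: negligible_pred_def)
  from rare_disj[OF this] show "rare e (\<lambda>n. P n \<or> Q n)" by simp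
qed

lemma negligible_pred_comp:
  fixes g :: "nat \<Rightarrow> nat"
  assumes "negligible_pred P" "inj_on g {1..}" "\<And>n. n \<ge> 1 \<Longrightarrow> 1 \<le> g n \<and> g n \<le> B * n" "B > 0"
  shows "negligible_pred (\<lambda>n. P (g n))"
  unfolding negligible_pred_def
proof safe
  fix e :: real assume "e > 0"
  then have "rare (e / real B) P"
    using assms by (simp add: negligible_pred_def)
  from rare_comp[OF this assms(2-4)] assms(4) show "rare e (\<lambda>n. P (g n))" by simp
qed

text \<open>The \<open>n\<close> in question lie in intervals \<open>[u, u * exp (d / a))\<close>
  whose left ends form a geometric progression. Their total length is at most
  \<open>x * (2 * d / a) * (2 * a)\<close>, and one extra point for each of the O(ln x) intervals is
  absorbed by \<open>d * x\<close>. The bound is uniform in \<open>a\<close>, which matters because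
  the size of the Kronecker frequencies is not controlled.\<close>

lemma rare_frac_ln:
  fixes a b d :: real
  assumes a: "a \<ge> 1" and d: "d > 0"
  shows "rare (5 * d) (\<lambda>n. frac (a * ln (real n) - b) < d)"
proof (cases "d \<ge> 1")
  case True
  then show ?thesis by (intro rare_one) simp
next
  case False
  then have d1: "d \<le> 1" by simp
  define r where "r = exp (- (1 / a))"
  have r: "0 < r" "r < 1" using a by (auto simp: r_def)
  have r': "1 - r \<ge> 1 / (2 * a)"
  proof -
    have "r = 1 / exp (1 / a)" by (simp add: r_def exp_minus field_simps)
    also have "\<dots> \<le> 1 / (1 + 1 / a)"
      using a exp_ge_add_one_self[of "1 / a"] by (intro divide_left_mono) (auto intro!: mult_pos_pos add_pos_pos)
    also have "\<dots> \<le> 1 - 1 / (2 * a)"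
      using a by (simp add: field_simps)
    finally show ?thesis by simp
  qed
  have q: "exp (d / a) - 1 \<le> 2 * d / a"
  proof -
    have da: "0 \<le> d / a" "d / a \<le> 1" using a d d1 by (auto simp: field_simps)
    have "exp (d / a) \<le> 1 + d / a + (d / a)\<^sup>2"
      using da by (intro exp_bound) auto
    also have "(d / a)\<^sup>2 \<le> d / a"
      using mult_right_mono[OF da(2) da(1)] by (simp add: power2_eq_square)
    finally show ?thesis by simp
  qed
  have "\<forall>\<^sub>F x in sequentially. a * ln (real x) + 3 \<le> d * real x"
    using d by real_asymp
  then show ?thesis
    unfolding rare_def using eventually_ge_at_top[of 1]
  proof eventually_elim
    case (elim x)
    \<comment> \<open>Intervals are numbered downwards from the one reached at \<open>x\<close>
      (integer part \<open>M\<close>) to the one reached at 1 (integer part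
      \<open>L\<close>).\<close>
    define M L where "M = \<lfloor>a * ln (real x) - b\<rfloor>" and "L = \<lfloor>- b\<rfloor>"
    define N where "N = nat (M - L)"
    define I where "I i = {n :: nat. exp ((of_int (M - int i) + b) / a) \<le> real n \<and>
        real n < exp ((of_int (M - int i) + b + d) / a)}" for i
    have lnx: "0 \<le> a * ln (real x)" using a elim by simp
    have LM: "L \<le> M" using lnx unfolding M_def L_def by (intro floor_mono) simp
    have fin: "finite (I i)" for i
      by (rule finite_subset[of _ "{..nat \<lceil>exp ((of_int (M - int i) + b + d) / a)\<rceil>}"])
         (auto simp: I_def, linarith)
    have sub: "{n\<in>{1..x}. frac (a * ln (real n) - b) < d} \<subseteq> (\<Union>i\<le>N. I i)"
    proof safe
      fix n assume n: "n \<in> {1..x}" "frac (a * ln (real n) - b) < d"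
      define m where "m = \<lfloor>a * ln (real n) - b\<rfloor>"
      have "L \<le> m" unfolding m_def L_def using n a by (intro floor_mono) simp
      moreover have "m \<le> M" unfolding m_def M_def using n a by (intro floor_mono) simp
      ultimately have N: "nat (M - m) \<le> N" and mM: "M - int (nat (M - m)) = m"
        unfolding N_def by auto
      have 1: "of_int m \<le> a * ln (real n) - b" "a * ln (real n) - b < of_int m + d"
        using n(2) unfolding m_def frac_def by linarith+
      have n0: "real n = exp (ln (real n))" using n by simp
      have "(of_int m + b) / a \<le> ln (real n)" "ln (real n) < (of_int m + b + d) / a"
        using 1 a by (simp_all add: field_simps)
      then have "n \<in> I (nat (M - m))"
        unfolding I_def mem_Collect_eq mM by (subst (1 2) n0) simp
      with N show "n \<in> (\<Union>i\<le>N. I i)" by blast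
    qed
    have card: "real (card (I i)) \<le> real x * (exp (d / a) - 1) * r ^ i + 1" for i
    proof -
      define u where "u = exp ((of_int (M - int i) + b) / a)"
      define v where "v = exp ((of_int (M - int i) + b + d) / a)"
      have "u = exp ((of_int M + b) / a) * r ^ i"
        by (simp add: u_def r_def flip: exp_of_nat_mult exp_add)
           (use a in \<open>simp add: field_simps\<close>)
      \<comment> \<open>The top interval may extend beyond \<open>x\<close>, but its left end does
        not, and lengths are proportional to left ends.\<close>
      also have "\<dots> \<le> real x * r ^ i"
      proof -
        have "(of_int M + b) / a \<le> ln (real x)"
          using a of_int_floor_le[of "a * ln (real x) - b"] unfolding M_def by (simp add: field_simps)
        then have "exp ((of_int M + b) / a) \<le> exp (ln (real x))" by simp
        also have "\<dots> = real x" using elim by simp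
        finally show ?thesis using r by (intro mult_right_mono) auto
      qed
      finally have u: "u \<le> real x * r ^ i" .
      have uv: "v = u * exp (d / a)"
        by (simp add: u_def v_def add_divide_distrib flip: exp_add)
      have u0: "u > 0" by (simp add: u_def)
      have "I i \<subseteq> {nat \<lceil>u\<rceil>..<nat \<lceil>v\<rceil>}"
        unfolding I_def u_def[symmetric] v_def[symmetric] using u0 by auto linarith+
      then have "card (I i) \<le> nat \<lceil>v\<rceil> - nat \<lceil>u\<rceil>"
        using card_mono[of "{nat \<lceil>u\<rceil>..<nat \<lceil>v\<rceil>}" "I i"] by simp
      also have "real (nat \<lceil>v\<rceil> - nat \<lceil>u\<rceil>) \<le> v - u + 1"
      proof -
        have "1 \<le> exp (d / a)" using d a by simp
        then have "u \<le> v" unfolding uv using u0 by simp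
        then have "\<lceil>u\<rceil> \<le> \<lceil>v\<rceil>" by (rule ceiling_mono)
        moreover have "0 \<le> \<lceil>u\<rceil>" using u0 by linarith
        ultimately have "int (nat \<lceil>v\<rceil> - nat \<lceil>u\<rceil>) = \<lceil>v\<rceil> - \<lceil>u\<rceil>" by linarith
        then have "real (nat \<lceil>v\<rceil> - nat \<lceil>u\<rceil>) = of_int (\<lceil>v\<rceil> - \<lceil>u\<rceil>)"
          by (metis of_int_of_nat_eq)
        then show ?thesis by linarith
      qed
      also have "v - u + 1 = u * (exp (d / a) - 1) + 1" by (simp add: uv algebra_simps)
      also have "\<dots> \<le> real x * r ^ i * (exp (d / a) - 1) + 1"
        using u d a by (intro add_right_mono mult_right_mono) auto
      finally show ?thesis by (simp add: mult_ac)
    qed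
    have "card {n\<in>{1..x}. frac (a * ln (real n) - b) < d} \<le> card (\<Union>i\<le>N. I i)"
      using fin by (intro card_mono sub) auto
    also have "\<dots> \<le> (\<Sum>i\<le>N. card (I i))"
      by (rule card_UN_le) simp
    also have "real \<dots> \<le> (\<Sum>i\<le>N. real x * (exp (d / a) - 1) * r ^ i + 1)"
      unfolding of_nat_sum by (intro sum_mono card)
    also have "\<dots> = real x * (exp (d / a) - 1) * (\<Sum>i\<le>N. r ^ i) + (real N + 1)"
      by (simp add: sum.distrib sum_distrib_left)
    also have "\<dots> \<le> 4 * d * real x + d * real x"
    proof (intro add_mono)
      have "real N + 1 \<le> a * ln (real x) + 3"
        using LM unfolding N_def M_def L_def by linarith
      with elim show "real N + 1 \<le> d * real x" by linarith
      have "(\<Sum>i\<le>N. r ^ i) = (\<Sum>i<Suc N. r ^ i)" by (simp only: lessThan_Suc_atMost)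
      also have "\<dots> = (1 - r ^ Suc N) / (1 - r)"
        using r by (subst sum_gp_strict) auto
      also have "\<dots> \<le> 1 / (1 - r)"
        using r by (intro divide_right_mono) auto
      also have "\<dots> \<le> 1 / (1 / (2 * a))"
        using r' r a by (intro divide_left_mono) auto
      finally have s: "(\<Sum>i\<le>N. r ^ i) \<le> 2 * a" by simp
      have "real x * (exp (d / a) - 1) * (\<Sum>i\<le>N. r ^ i) \<le> real x * (2 * d / a) * (2 * a)"
        using q s a d r by (intro mult_mono mult_left_mono sum_nonneg) auto
      also have "\<dots> = 4 * d * real x" using a by simp
      finally show "real x * (exp (d / a) - 1) * (\<Sum>i\<le>N. r ^ i) \<le> 4 * d * real x" .
    qed
    finally show ?case by (simp add: algebra_simps)
  qed
qed

section \<open>Kronecker frequencies\<close>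

text \<open>Unique factorisation: with positive and negative coefficients on opposite sides, an
  integer relation exponentiates to an equality of two products of prime powers.\<close>

lemma independent_ln_primes:
  assumes "\<And>p. p \<in> Q \<Longrightarrow> prime (p :: nat)"
  shows "module.independent (\<lambda>r. (*) (real_of_int r)) ((\<lambda>p. ln (real p)) ` Q)"
proof -
  interpret Modules.module "(\<lambda>r. (*) (real_of_int r))"
    by (simp add: Modules.module.intro distrib_left mult.commute)
  show ?thesis
    unfolding independent_explicit_module
  proof (intro allI impI)
    fix t :: "real set" and u v
    assume t: "finite t" "t \<subseteq> (\<lambda>p. ln (real p)) ` Q" "(\<Sum>v\<in>t. real_of_int (u v) * v) = 0" "v \<in> t"
    obtain R where R: "R \<subseteq> Q" "inj_on (\<lambda>p. ln (real p)) R" "t = (\<lambda>p. ln (real p)) ` R"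
      using t(2) by (auto simp: subset_image_inj)
    have finR: "finite R" using t(1) R by (simp add: finite_image_iff)
    have pr: "prime p" if "p \<in> R" for p using that R assms by auto
    define c where "c p = u (ln (real p))" for p :: nat
    have "(\<Sum>p\<in>R. real_of_int (c p) * ln (real p)) = 0"
      using t(3) unfolding R(3) c_def by (subst (asm) sum.reindex[OF R(2)]) simp
    moreover have "real_of_int (c p) = real (nat (c p)) - real (nat (- c p))" for p
      by (cases "c p \<ge> 0") auto
    ultimately have "(\<Sum>p\<in>R. (real (nat (c p)) - real (nat (- c p))) * ln (real p)) = 0"
      by simp
    then have eq: "(\<Sum>p\<in>R. real (nat (c p)) * ln (real p)) = (\<Sum>p\<in>R. real (nat (- c p)) * ln (real p))"
      by (simp add: left_diff_distrib sum_subtractf)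
    have ln_prod: "real (\<Prod>p\<in>R. p ^ h p) = exp (\<Sum>p\<in>R. real (h p) * ln (real p))" for h
    proof -
      have "exp (\<Sum>p\<in>R. real (h p) * ln (real p)) = (\<Prod>p\<in>R. exp (real (h p) * ln (real p)))"
        using finR by (rule exp_sum)
      also have "\<dots> = (\<Prod>p\<in>R. real p ^ h p)"
        using pr by (intro prod.cong) (auto simp: exp_of_nat_mult prime_gt_0_nat)
      finally show ?thesis by simp
    qed
    have "real (\<Prod>p\<in>R. p ^ nat (c p)) = real (\<Prod>p\<in>R. p ^ nat (- c p))"
      unfolding ln_prod eq ..
    then have eq2: "(\<Prod>p\<in>R. p ^ nat (c p)) = (\<Prod>p\<in>R. p ^ nat (- c p))"
      by (simp only: of_nat_eq_iff)
    obtain p where p: "p \<in> R" "v = ln (real p)" using t(4) R(3) by auto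
    have "multiplicity p (\<Prod>p\<in>R. p ^ h p) = h p" for h
      using multiplicity_prod_prime_powers[OF finR pr pr[OF p(1)]] p(1) by simp
    \<comment> \<open>At least one of these two truncations is 0, so their equality forces
      \<open>c p = 0\<close>.\<close>
    then have "nat (c p) = nat (- c p)" using eq2 by metis
    then show "u v = 0" by (simp add: c_def p(2))
  qed
qed

text \<open>Kronecker's theorem is applied with target 1/2 where \<open>s p\<close> holds and 0
  elsewhere. Doubling \<open>t\<close> turns these targets modulo 1 into odd and even integers, and
  the tolerance \<open>e / 2\<close> into \<open>e\<close>.\<close>

lemma exists_frequency:
  fixes s :: "nat \<Rightarrow> bool" and e :: real
  assumes "s 2" "N \<ge> 2" "0 < e" "e \<le> 1/4"
  obtains a where "a \<ge> 1"
    "\<And>p. prime p \<Longrightarrow> p \<le> N \<Longrightarrow> \<exists>m. \<bar>a * ln (real p) - of_int m\<bar> \<le> e \<and> (odd m \<longleftrightarrow> s p)"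
proof -
  define Q where "Q = {p. prime p \<and> p \<le> N}"
  have finQ: "finite Q" by (rule finite_subset[of _ "{..N}"]) (auto simp: Q_def)
  obtain q where q: "bij_betw q {..<card Q} Q"
    using ex_bij_betw_nat_finite[OF finQ] by (auto simp: atLeast0LessThan)
  have qQ: "q ` {..<card Q} = Q" using q by (simp add: bij_betw_def)
  have lnq: "(\<lambda>i. ln (real (q i))) ` {..<card Q} = (\<lambda>p. ln (real p)) ` Q"
    using qQ by (force simp: image_image)
  have ind: "module.independent (\<lambda>r. (*) (real_of_int r)) ((\<lambda>i. ln (real (q i))) ` {..<card Q})"
    unfolding lnq by (rule independent_ln_primes) (simp add: Q_def)
  have "inj_on (\<lambda>i. ln (real (q i))) {..<card Q}"
  proof (rule inj_onI)
    fix i j assume ij: "i \<in> {..<card Q}" "j \<in> {..<card Q}" "ln (real (q i)) = ln (real (q j))"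
    then have "q i \<in> Q" "q j \<in> Q" using qQ by auto
    then have "q i > 0" "q j > 0" by (auto simp: Q_def prime_gt_0_nat)
    with ij(3) have "q i = q j" by simp
    with q ij show "i = j" by (auto simp: bij_betw_def inj_on_def)
  qed
  then obtain t h where th: "\<And>i. i < card Q \<Longrightarrow>
      \<bar>t * ln (real (q i)) - of_int (h i) - (if s (q i) then 1/2 else 0)\<bar> < e / 2"
    using Kronecker_thm_1[OF ind _ half_gt_zero[OF assms(3)],
        where \<alpha> = "\<lambda>i. if s (q i) then 1/2 else 0"] by auto
  have ex: "\<exists>m. \<bar>2 * t * ln (real p) - of_int m\<bar> \<le> e \<and> (odd m \<longleftrightarrow> s p)" if "prime p" "p \<le> N" for p
  proof -
    have "p \<in> Q" using that by (simp add: Q_def)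
    then obtain i where i: "i < card Q" "p = q i" using qQ by auto
    show ?thesis
    proof (cases "s p")
      case True
      then have "\<bar>t * ln (real p) - of_int (h i) - 1 / 2\<bar> < e / 2"
        using th[OF i(1)] i(2) by simp
      then have "\<bar>2 * (t * ln (real p)) - of_int (2 * h i + 1)\<bar> \<le> e"
        unfolding of_int_add of_int_mult of_int_numeral of_int_1 by linarith
      with True show ?thesis
        by (intro exI[of _ "2 * h i + 1"]) (simp add: mult.assoc)
    next
      case False
      then have "\<bar>t * ln (real p) - of_int (h i)\<bar> < e / 2"
        using th[OF i(1)] i(2) by simp
      then have "\<bar>2 * (t * ln (real p)) - of_int (2 * h i)\<bar> \<le> e"
        unfolding of_int_mult of_int_numeral by linarith
      with False show ?thesis
        by (intro exI[of _ "2 * h i"]) (simp add: mult.assoc)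
    qed
  qed
  \<comment> \<open>\<open>a ln 2\<close> is close to an odd integer, so \<open>a\<close> cannot be small.\<close>
  have t1: "\<bar>2 * t\<bar> \<ge> 1"
  proof -
    obtain m where m: "\<bar>2 * t * ln 2 - of_int m\<bar> \<le> e" "odd m"
      using ex[of 2] assms by auto
    then have "m \<noteq> 0" by auto
    then have "\<bar>real_of_int m\<bar> \<ge> 1" by linarith
    then have "\<bar>2 * t * ln 2\<bar> \<ge> 3/4" using m assms by linarith
    then have 1: "3/4 \<le> \<bar>2 * t\<bar> * ln 2" by (simp add: abs_mult)
    also have "\<dots> \<le> \<bar>2 * t\<bar> * (25/36)"
      using ln2_le_25_over_36 by (intro mult_left_mono) auto
    finally show ?thesis by simp
  qed
  \<comment> \<open>\<open>t\<close> may be negative; passing to the absolute value negates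
    \<open>m\<close> and keeps its parity.\<close>
  show thesis
  proof (rule that[OF t1])
    fix p :: nat assume p: "prime p" "p \<le> N"
    then obtain m where m: "\<bar>2 * t * ln (real p) - of_int m\<bar> \<le> e" "odd m \<longleftrightarrow> s p"
      using ex by blast
    show "\<exists>m. \<bar>\<bar>2 * t\<bar> * ln (real p) - of_int m\<bar> \<le> e \<and> (odd m \<longleftrightarrow> s p)"
    proof (cases "t \<ge> 0")
      case True
      with m show ?thesis by auto
    next
      case False
      with m show ?thesis by (intro exI[of _ "- m"]) auto
    qed
  qed
qed

section \<open>A slowly varying sign with prescribed multiplicative behaviour\<close>

text \<open>
  The function \<open>\<psi>\<close> equals \<open>\<theta> j\<close> on blocks \<open>[Y j, Y (j + 1))\<close>, which grow so fast that \<open>n\<close> and \<open>g i n\<close>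
  lie in the same or in adjacent blocks.
\<close>

lemma glue_slowly_varying:
  fixes \<theta> :: "nat \<Rightarrow> nat \<Rightarrow> bool" and g :: "nat \<Rightarrow> nat \<Rightarrow> nat" and c :: "nat \<Rightarrow> bool"
  assumes step: "\<And>j. rare (e' j) (\<lambda>n. \<theta> j n \<noteq> \<theta> (Suc j) n)" "e' \<longlonglongrightarrow> 0"
    and cond: "\<And>i j. i \<in> I \<Longrightarrow> rare (e i j) (\<lambda>n. \<theta> j (g i n) \<noteq> (\<theta> j n \<noteq> c i))"
      "\<And>i. i \<in> I \<Longrightarrow> e i \<longlonglongrightarrow> 0"
    and g: "\<And>i n. i \<in> I \<Longrightarrow> n \<ge> 1 \<Longrightarrow> n \<le> g i n \<and> g i n \<le> (i + 2) * n"
  obtains \<psi> where "\<And>i. i \<in> I \<Longrightarrow> negligible_pred (\<lambda>n. \<psi> (g i n) \<noteq> (\<psi> n \<noteq> c i))"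
proof -
  define T where "T j n \<longleftrightarrow> \<theta> j n \<noteq> \<theta> (Suc j) n" for j n
  define C where "C i j n \<longleftrightarrow> \<theta> j (g i n) \<noteq> (\<theta> j n \<noteq> c i)" for i j n
  define cnt where "cnt P x = real (card {n\<in>{1..x}. P n})" for P :: "nat \<Rightarrow> bool" and x
  have "\<forall>j. \<exists>X. \<forall>x\<ge>X. cnt (T j) x \<le> e' j * real x \<and>
           (\<forall>i\<in>I \<inter> {..j}. cnt (C i j) x \<le> e i j * real x)"
  proof
    fix j
    have "\<forall>\<^sub>F x in sequentially. cnt (T j) x \<le> e' j * real x \<and>
           (\<forall>i\<in>I \<inter> {..j}. cnt (C i j) x \<le> e i j * real x)"
      using step(1) cond(1)
      by (intro eventually_conj eventually_ball_finite)
         (auto simp: rare_def T_def C_def cnt_def)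
    then show "\<exists>X. \<forall>x\<ge>X. cnt (T j) x \<le> e' j * real x \<and>
           (\<forall>i\<in>I \<inter> {..j}. cnt (C i j) x \<le> e i j * real x)"
      by (simp add: eventually_sequentially)
  qed
  then obtain X where X: "\<And>j x. x \<ge> X j \<Longrightarrow> cnt (T j) x \<le> e' j * real x"
      "\<And>i j x. x \<ge> X j \<Longrightarrow> i \<in> I \<Longrightarrow> i \<le> j \<Longrightarrow> cnt (C i j) x \<le> e i j * real x"
    by (metis IntI atMost_iff)
  \<comment> \<open>The factor \<open>j + 3\<close> makes \<open>Y k\<close> a small fraction of
    \<open>Y (Suc k)\<close> and, once \<open>i\<close> is at most \<open>j\<close>, prevents
    \<open>g i n\<close> from skipping a block. The three values of \<open>X\<close> make the
    counting bounds with indices \<open>j\<close> to \<open>j + 2\<close> valid from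
    \<open>Y (Suc j)\<close> on.\<close>
  define Y where "Y = rec_nat 0 (\<lambda>j y. (j + 3) * (y + 1) + X j + X (Suc j) + X (Suc (Suc j)))"
  have Y0: "Y 0 = 0" and Ysuc: "Y (Suc j) = (j + 3) * (Y j + 1) + X j + X (Suc j) + X (Suc (Suc j))" for j
    by (simp_all add: Y_def)
  have Ygrow: "(j + 3) * Y j \<le> Y (Suc j)" for j
    by (simp add: Ysuc)
  have Yless: "Y j < Y (Suc j)" for j
  proof -
    have "Y j \<le> (j + 3) * Y j" by simp
    also have "\<dots> < (j + 3) * (Y j + 1)" by (intro mult_strict_left_mono) auto
    also have "\<dots> \<le> Y (Suc j)" by (simp only: Ysuc add.assoc le_add1)
    finally show ?thesis .
  qed
  then have Ysm: "strict_mono Y"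
    by (simp add: strict_mono_Suc_iff)
  have "\<forall>n. \<exists>j. Y j \<le> n \<and> n < Y (Suc j)"
  proof
    fix n
    have ex: "n < Y (Suc n)"
      using strict_mono_imp_increasing[OF Ysm, of "Suc n"] by simp
    define k where "k = (LEAST k. n < Y (Suc k))"
    have "n < Y (Suc k)" unfolding k_def using ex by (rule LeastI)
    moreover have "Y k \<le> n"
    proof (cases k)
      case (Suc l)
      then have "\<not> n < Y (Suc l)" using not_less_Least[of l "\<lambda>k. n < Y (Suc k)"] k_def by simp
      with Suc show ?thesis by simp
    qed (simp add: Y0)
    ultimately show "\<exists>j. Y j \<le> n \<and> n < Y (Suc j)" by blast
  qed
  then obtain J where J: "\<And>n. Y (J n) \<le> n" "\<And>n. n < Y (Suc (J n))"
    by metis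
  have Jless: "J n \<le> j" if "n < Y (Suc j)" for n j
    using that J(1)[of n] strict_mono_less[OF Ysm, of "J n" "Suc j"] by linarith
  have Jge: "j \<le> J n" if "Y j \<le> n" for n j
    using that J(2)[of n] strict_mono_less[OF Ysm, of j "Suc (J n)"] by linarith
  define \<psi> where "\<psi> n = \<theta> (J n) n" for n
  show thesis
  proof (rule that)
    fix i assume i: "i \<in> I"
    define bad where "bad n \<longleftrightarrow> \<psi> (g i n) \<noteq> (\<psi> n \<noteq> c i)" for n
    have "negligible_pred bad"
      unfolding negligible_pred_def
    proof safe
      fix \<epsilon> :: real assume \<epsilon>: "\<epsilon> > 0"
      have "\<forall>\<^sub>F j in sequentially. e' j < \<epsilon> / 8 \<and> e i j < \<epsilon> / 8 \<and> i \<le> j \<and> 8 / \<epsilon> \<le> real j"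
        using \<epsilon> step(2) cond(2)[OF i]
        by (intro eventually_conj order_tendstoD eventually_ge_at_top) (auto, real_asymp)
      then obtain N where N: "\<And>j. j \<ge> N \<Longrightarrow> e' j < \<epsilon> / 8" "\<And>j. j \<ge> N \<Longrightarrow> e i j < \<epsilon> / 8"
          "\<And>j. j \<ge> N \<Longrightarrow> i \<le> j" "\<And>j. j \<ge> N \<Longrightarrow> 8 / \<epsilon> \<le> real j"
        unfolding eventually_sequentially by blast
      show "rare \<epsilon> bad"
        unfolding rare_def using eventually_ge_at_top[of "Y (Suc N)"]
      proof eventually_elim
        case (elim x)
        \<comment> \<open>Everything before block \<open>k\<close> is given up. The remaining
          \<open>n\<close> lie in blocks \<open>k\<close> and \<open>Suc k\<close>, their images at
          most one block further. This yields six error terms, each at most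
          \<open>\<epsilon> / 8 * x\<close>.\<close>
        obtain k where k: "J x = Suc k" "k \<ge> N"
          using Jge[OF elim] by (cases "J x") auto
        have x: "Y (Suc k) \<le> x" using J(1)[of x] k by simp
        have cover: "n < Y k \<or> T k n \<or> T (Suc k) n \<or> C i k n \<or> C i (Suc k) n \<or> C i (Suc (Suc k)) n"
          if n: "n \<in> {1..x}" "bad n" for n
        proof (cases "n < Y k")
          case False
          define m where "m = J n"
          have m: "m = k \<or> m = Suc k"
            using False Jge[of k n] Jless[of n "Suc k"] n(1) J(2)[of x] k by (auto simp: m_def)
          have gn: "n \<le> g i n" "g i n \<le> (i + 2) * n" using g[OF i] n by auto
          have "m \<le> J (g i n)"
            using Jge[of m "g i n"] J(1)[of n] gn by (simp add: m_def)
          moreover have "J (g i n) \<le> Suc m"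
          proof (rule Jless)
            have "g i n \<le> (m + 4) * n"
              using gn(2) N(3)[OF k(2)] m mult_right_mono[of "i + 2" "m + 4" n] by auto
            also have "\<dots> < (m + 4) * Y (Suc m)"
              using J(2)[of n] by (simp add: m_def)
            also have "\<dots> \<le> Y (Suc (Suc m))"
              using Ygrow[of "Suc m"] by (simp add: numeral_eq_Suc)
            finally show "g i n < Y (Suc (Suc m))" .
          qed
          ultimately have "J (g i n) = m \<or> J (g i n) = Suc m" by linarith
          \<comment> \<open>If the image lies in the next block, the relation for
            \<open>\<theta> (Suc m)\<close> is used, and the change from \<open>\<theta> m\<close>
            to \<open>\<theta> (Suc m)\<close> is made at \<open>n\<close> itself.\<close>
          then have "C i m n \<or> C i (Suc m) n \<or> T m n"
            using n(2) unfolding bad_def C_def T_def \<psi>_def m_def[symmetric] by metis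
          with m show ?thesis by blast
        qed simp
        let ?s = "\<lambda>P. {n\<in>{1..x}. P n}"
        have "?s bad \<subseteq> {..<Y k} \<union> ?s (T k) \<union> ?s (T (Suc k)) \<union>
            ?s (C i k) \<union> ?s (C i (Suc k)) \<union> ?s (C i (Suc (Suc k)))"
          using cover by blast
        then have "card (?s bad) \<le> card ({..<Y k} \<union> ?s (T k) \<union> ?s (T (Suc k)) \<union>
            ?s (C i k) \<union> ?s (C i (Suc k)) \<union> ?s (C i (Suc (Suc k))))"
          by (intro card_mono) auto
        also have "\<dots> \<le> card {..<Y k} + card (?s (T k)) + card (?s (T (Suc k))) +
            card (?s (C i k)) + card (?s (C i (Suc k))) + card (?s (C i (Suc (Suc k))))"
          by (intro order_trans[OF card_Un_le] add_mono order_refl)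
        finally have total: "real (card (?s bad)) \<le> real (Y k) + cnt (T k) x + cnt (T (Suc k)) x +
            cnt (C i k) x + cnt (C i (Suc k)) x + cnt (C i (Suc (Suc k))) x"
          unfolding cnt_def by (simp only: card_lessThan flip: of_nat_add of_nat_le_iff)
        have Yk: "real (Y k) \<le> \<epsilon> / 8 * real x"
        proof -
          have "8 / \<epsilon> * real (Y k) \<le> real (k + 3) * real (Y k)"
            using N(4)[OF k(2)] by (intro mult_right_mono) auto
          also have "\<dots> \<le> real x"
            using order_trans[OF Ygrow[of k] x] by (simp only: of_nat_mult[symmetric] of_nat_le_iff)
          finally show ?thesis using \<epsilon> by (simp add: field_simps)
        qed
        have Tj: "cnt (T j) x \<le> \<epsilon> / 8 * real x" if "j = k \<or> j = Suc k" for j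
        proof -
          have "X j \<le> x" using that x by (auto simp: Ysuc)
          from X(1)[OF this] have "cnt (T j) x \<le> e' j * real x" .
          also have "\<dots> \<le> \<epsilon> / 8 * real x"
            using N(1)[of j] that k(2) by (intro mult_right_mono) auto
          finally show ?thesis .
        qed
        have Cj: "cnt (C i j) x \<le> \<epsilon> / 8 * real x" if "j = k \<or> j = Suc k \<or> j = Suc (Suc k)" for j
        proof -
          have "X j \<le> x" using that x by (auto simp: Ysuc)
          moreover have "i \<le> j" using N(3)[OF k(2)] that by auto
          ultimately have "cnt (C i j) x \<le> e i j * real x" using X(2)[OF _ i] by blast
          also have "\<dots> \<le> \<epsilon> / 8 * real x"
            using N(2)[of j] that k(2) by (intro mult_right_mono) auto
          finally show ?thesis .
        qed
        have "6 * (\<epsilon> / 8 * real x) \<le> \<epsilon> * real x" using \<epsilon> by simp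
        moreover have "cnt (T k) x \<le> \<epsilon> / 8 * real x" "cnt (T (Suc k)) x \<le> \<epsilon> / 8 * real x"
          by (rule Tj, simp)+
        moreover have "cnt (C i k) x \<le> \<epsilon> / 8 * real x" "cnt (C i (Suc k)) x \<le> \<epsilon> / 8 * real x"
            "cnt (C i (Suc (Suc k))) x \<le> \<epsilon> / 8 * real x"
          by (rule Cj, simp)+
        ultimately show "real (card (?s bad)) \<le> \<epsilon> * real x"
          using total Yk by linarith
      qed
    qed
    then show "negligible_pred (\<lambda>n. \<psi> (g i n) \<noteq> (\<psi> n \<noteq> c i))"
      unfolding bad_def .
  qed
qed

section \<open>Passing gradually from one frequency to another\<close>

lemma floor_eq_floor_add:
  fixes z w d :: real
  assumes "\<bar>w - z - of_int m\<bar> \<le> d" "frac (z + d) \<ge> 2 * d"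
  shows "\<lfloor>w\<rfloor> = \<lfloor>z\<rfloor> + m"
proof -
  \<comment> \<open>The second hypothesis puts \<open>z - d\<close> and \<open>z + d\<close> between
    the same consecutive integers.\<close>
  have "\<lfloor>z\<rfloor> = \<lfloor>z + d\<rfloor>"
    using assms unfolding frac_def by (intro floor_unique) linarith+
  moreover have "\<lfloor>w\<rfloor> = \<lfloor>z + d\<rfloor> + m"
    using assms unfolding frac_def by (intro floor_unique) (simp, linarith)+
  ultimately show ?thesis by simp
qed

lemma frac_less_of_floor_diff_less:
  fixes z d :: real
  assumes "\<lfloor>z - d\<rfloor> < \<lfloor>z\<rfloor>"
  shows "frac z < d"
  using assms unfolding frac_def by linarith

text \<open>
  The condition \<open>\<lfloor>x - c\<rfloor> < \<lfloor>x\<rfloor>\<close> says that the fractional part of \<open>x\<close> is less than \<open>c\<close>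
  (for \<open>0 \<le> c \<le> 1\<close>), so \<open>c = 0\<close> selects the frequency \<open>a\<close> and \<open>c = 1\<close> the frequency \<open>b\<close>.
\<close>

definition phase_parity :: "real \<Rightarrow> real \<Rightarrow> real \<Rightarrow> nat \<Rightarrow> bool" where
  "phase_parity a b c n \<longleftrightarrow>
     odd (if \<lfloor>a * ln (real n) - c\<rfloor> < \<lfloor>a * ln (real n)\<rfloor>
          then \<lfloor>b * ln (real n)\<rfloor> else \<lfloor>a * ln (real n)\<rfloor>)"

text \<open>Off three sets of density at most \<open>10 * d\<close>, all three floors shift by their
  integers. The two floors being compared shift by the same \<open>m\<close>, so the same frequency
  is selected, and \<open>m\<close> and \<open>l\<close> both have the parity \<open>s\<close>. The
  31st \<open>d\<close> pays for the finitely many \<open>n\<close> where the hypotheses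
  fail.\<close>

lemma rare_phase_parity_perturb:
  fixes g :: "nat \<Rightarrow> nat"
  assumes "a \<ge> 1" "b \<ge> 1" "d > 0"
    and a: "\<forall>\<^sub>F n in sequentially. \<bar>a * ln (real (g n)) - a * ln (real n) - of_int m\<bar> \<le> d" "odd m \<longleftrightarrow> s"
    and b: "\<forall>\<^sub>F n in sequentially. \<bar>b * ln (real (g n)) - b * ln (real n) - of_int l\<bar> \<le> d" "odd l \<longleftrightarrow> s"
  shows "rare (31 * d) (\<lambda>n. phase_parity a b c (g n) \<noteq> (phase_parity a b c n \<noteq> s))"
proof -
  define B where "B n \<longleftrightarrow> frac (a * ln (real n) - (- d)) < 2 * d \<or>
      (frac (a * ln (real n) - (c - d)) < 2 * d \<or> frac (b * ln (real n) - (- d)) < 2 * d)" for n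
  have "rare (5 * (2 * d) + (5 * (2 * d) + 5 * (2 * d))) B"
    unfolding B_def using assms by (intro rare_disj rare_frac_ln) auto
  then show ?thesis
  proof (rule rare_eventually_mono)
    show "\<forall>\<^sub>F n in sequentially. phase_parity a b c (g n) \<noteq> (phase_parity a b c n \<noteq> s) \<longrightarrow> B n"
      using a(1) b(1)
    proof eventually_elim
      case (elim n)
      show ?case
      proof (rule impI, rule ccontr)
        assume ne: "phase_parity a b c (g n) \<noteq> (phase_parity a b c n \<noteq> s)" and "\<not> B n"
        then have B: "2 * d \<le> frac (a * ln (real n) + d)"
            "2 * d \<le> frac (a * ln (real n) - c + d)" "2 * d \<le> frac (b * ln (real n) + d)"
          by (auto simp: B_def algebra_simps)
        have "\<lfloor>a * ln (real (g n))\<rfloor> = \<lfloor>a * ln (real n)\<rfloor> + m"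
          using elim(1) B(1) by (rule floor_eq_floor_add)
        moreover have "\<lfloor>a * ln (real (g n)) - c\<rfloor> = \<lfloor>a * ln (real n) - c\<rfloor> + m"
          using elim(1) B(2) by (intro floor_eq_floor_add) (auto simp: algebra_simps)
        moreover have "\<lfloor>b * ln (real (g n))\<rfloor> = \<lfloor>b * ln (real n)\<rfloor> + l"
          using elim(2) B(3) by (rule floor_eq_floor_add)
        ultimately show False
          using ne a(2) b(2) by (auto simp: phase_parity_def split: if_splits)
      qed
    qed
  qed (use assms in simp)
qed

text \<open>Raising the threshold changes the selected frequency only where the fractional part of
  \<open>a * ln n - c\<close> is below \<open>d\<close>.\<close>

lemma rare_phase_parity_step:
  assumes "a \<ge> 1" "d > 0"
  shows "rare (5 * d) (\<lambda>n. phase_parity a b c n \<noteq> phase_parity a b (c + d) n)"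
proof (rule rare_mono[OF rare_frac_ln[OF assms]])
  fix n :: nat
  let ?x = "a * ln (real n)"
  assume ne: "phase_parity a b c n \<noteq> phase_parity a b (c + d) n"
  have "(\<lfloor>?x - c\<rfloor> < \<lfloor>?x\<rfloor>) \<noteq> (\<lfloor>?x - (c + d)\<rfloor> < \<lfloor>?x\<rfloor>)"
  proof
    assume eq: "(\<lfloor>?x - c\<rfloor> < \<lfloor>?x\<rfloor>) = (\<lfloor>?x - (c + d)\<rfloor> < \<lfloor>?x\<rfloor>)"
    show False using ne unfolding phase_parity_def eq by simp
  qed
  moreover have "\<lfloor>?x - (c + d)\<rfloor> \<le> \<lfloor>?x - c\<rfloor>"
    using assms by (intro floor_mono) simp
  ultimately have "\<lfloor>?x - c - d\<rfloor> < \<lfloor>?x - c\<rfloor>"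
    by (auto simp: algebra_simps)
  then show "frac (?x - c) < d" by (rule frac_less_of_floor_diff_less)
qed simp

text \<open>A completed passage from \<open>a\<close> to \<open>b\<close> coincides with the start
  of any passage from \<open>b\<close>, so passages can be chained without a jump.\<close>

lemma phase_parity_one: "phase_parity a b 1 = phase_parity b b' 0"
  by (auto simp: phase_parity_def fun_eq_iff)

section \<open>The schedule of frequencies and thresholds\<close>

lemma filterlim_floor_sqrt: "filterlim floor_sqrt at_top at_top"
  unfolding filterlim_at_top
proof
  fix z
  show "\<forall>\<^sub>F n in at_top. z \<le> floor_sqrt n"
    using eventually_ge_at_top[of "z\<^sup>2"] by eventually_elim (simp add: le_floor_sqrt_iff)
qed

lemma exists_multiplicative_sign:
  fixes s :: "nat \<Rightarrow> bool"
  assumes s2: "s 2"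
  obtains \<psi> where "negligible_pred (\<lambda>n. \<psi> (n + 1) \<noteq> \<psi> n)"
    "\<And>p. prime p \<Longrightarrow> negligible_pred (\<lambda>n. \<psi> (p * n) \<noteq> (\<psi> n \<noteq> s p))"
proof -
  define d where "d k = 1 / (real k + 4)" for k
  have d: "0 < d k" "d k \<le> 1 / 4" for k by (auto simp: d_def)
  have "\<forall>k. \<exists>a\<ge>1. \<forall>p. prime p \<longrightarrow> p \<le> k + 2 \<longrightarrow>
      (\<exists>m. \<bar>a * ln (real p) - of_int m\<bar> \<le> d k \<and> (odd m \<longleftrightarrow> s p))"
    using exists_frequency[of s, OF s2 _ d] by (metis le_add2)
  then obtain a where a: "\<And>k. a k \<ge> 1" and am: "\<And>k p. prime p \<Longrightarrow> p \<le> k + 2 \<Longrightarrow>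
      \<exists>m. \<bar>a k * ln (real p) - of_int m\<bar> \<le> d k \<and> (odd m \<longleftrightarrow> s p)"
    by metis
  \<comment> \<open>For \<open>k\<^sup>2 \<le> j < (k + 1)\<^sup>2\<close> the threshold runs from 0 to 1 in steps of \<open>1 / (2 k + 1)\<close>.\<close>
  define k where "k j = floor_sqrt j" for j
  have k_lim: "filterlim k at_top at_top" unfolding k_def by (rule filterlim_floor_sqrt)
  define c where "c j = (real j - real (k j)^2) / (2 * real (k j) + 1)" for j
  define \<theta> where "\<theta> j = phase_parity (a (k j)) (a (Suc (k j))) (c j)" for j
  define e' where "e' j = 5 * (1 / (2 * real (k j) + 1))" for j
  \<comment> \<open>The trivial bound 1 covers the finitely many stages at which \<open>i\<close> is
    not yet within the range of the frequencies.\<close>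
  define e where "e i j = (if i \<le> k j + 2 then 31 * d (k j) else 1)" for i j :: nat
  \<comment> \<open>Index 0, not a prime, encodes the shift \<open>n + 1\<close> with no sign
    change, so gluing treats it together with all multiplications by primes.\<close>
  define g where "g i n = (if i = 0 then n + 1 else i * n)" for i n :: nat
  define t where "t i \<longleftrightarrow> i \<noteq> 0 \<and> s i" for i :: nat
  have "rare (e' j) (\<lambda>n. \<theta> j n \<noteq> \<theta> (Suc j) n)" for j
  proof -
    define q where "q = 1 / (2 * real (k j) + 1)"
    have "\<theta> (Suc j) = phase_parity (a (k j)) (a (Suc (k j))) (c j + q)"
    \<comment> \<open>At a square the threshold has just reached 1, and the next pair of frequencies
      takes over with threshold 0.\<close>
    proof (cases "Suc j = (Suc (k j))\<^sup>2")
      case True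
      have kS: "k (Suc j) = Suc (k j)" unfolding k_def using True
        by (metis floor_sqrt_inverse_power2 k_def)
      have *: "real j + 1 = (real (k j) + 1)\<^sup>2"
        using arg_cong[OF True, of real] by (simp add: add.commute)
      have "c j + q = (real j - real (k j)^2 + 1) / (2 * real (k j) + 1)"
        by (simp add: c_def q_def add_divide_distrib)
      also have "real j - real (k j)^2 + 1 = 2 * real (k j) + 1"
        using * by (simp add: power2_eq_square algebra_simps)
      finally have "c j + q = 1" by simp
      moreover have "c (Suc j) = 0" unfolding c_def kS using * by (simp add: add.commute)
      ultimately show ?thesis
        unfolding \<theta>_def kS by (simp add: phase_parity_one[of _ _ "a (Suc (Suc (k j)))"])
    next
      case False
      have "k (Suc j) = k j" unfolding k_def
      proof (rule floor_sqrt_unique)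
        show "(floor_sqrt j)\<^sup>2 \<le> Suc j" using floor_sqrt_power2_le[of j] by linarith
        show "Suc j < (Suc (floor_sqrt j))\<^sup>2"
          using False Suc_floor_sqrt_power2_gt[of j] unfolding k_def by linarith
      qed
      then show ?thesis
        unfolding \<theta>_def c_def q_def by (simp add: add_divide_distrib[symmetric] algebra_simps)
    qed
    then show ?thesis
      unfolding \<theta>_def e'_def using rare_phase_parity_step[OF a, of q] by (simp add: q_def)
  qed
  moreover have "e' \<longlonglongrightarrow> 0"
  proof -
    have "((\<lambda>x::nat. 5 * (1 / (2 * real x + 1))) \<longlongrightarrow> 0) at_top" by real_asymp
    from filterlim_compose[OF this k_lim] show ?thesis by (simp add: e'_def[abs_def])
  qed
  moreover have "rare (e i j) (\<lambda>n. \<theta> j (g i n) \<noteq> (\<theta> j n \<noteq> t i))" if i: "i \<in> {0} \<union> Collect prime" for i j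
  proof (cases "i \<le> k j + 2")
    case True
    have dS: "d (Suc (k j)) \<le> d (k j)" by (simp add: d_def field_simps)
    have "rare (31 * d (k j)) (\<lambda>n. \<theta> j (g i n) \<noteq> (\<theta> j n \<noteq> t i))"
    proof (cases "i = 0")
      case True
      have "\<forall>\<^sub>F n in sequentially. \<bar>x * ln (real (n + 1)) - x * ln (real n) - of_int 0\<bar> \<le> y"
        if "x \<ge> 1" "y > 0" for x y :: real
        using that by real_asymp
      from this[OF a d(1)] show ?thesis
        unfolding \<theta>_def g_def t_def using True a d
        by (intro rare_phase_parity_perturb[where m = 0 and l = 0]) auto
    next
      case False
      with i have i: "prime i" by simp
      obtain m where m: "\<bar>a (k j) * ln (real i) - of_int m\<bar> \<le> d (k j)" "odd m \<longleftrightarrow> s i"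
        using am[OF i] True by blast
      obtain l where l: "\<bar>a (Suc (k j)) * ln (real i) - of_int l\<bar> \<le> d (k j)" "odd l \<longleftrightarrow> s i"
        using am[OF i, of "Suc (k j)"] True order_trans[OF _ dS] by (metis add_Suc le_SucI)
      have ev: "\<forall>\<^sub>F n in sequentially. \<bar>x * ln (real (i * n)) - x * ln (real n) - of_int m\<bar> \<le> y"
        if "\<bar>x * ln (real i) - of_int m\<bar> \<le> y" for x y m
        using eventually_gt_at_top[of 0] by eventually_elim
          (use that i in \<open>simp add: ln_mult prime_gt_0_nat algebra_simps\<close>)
      show ?thesis
        unfolding \<theta>_def g_def t_def using False a d ev[OF m(1)] ev[OF l(1)] m(2) l(2)
        by (intro rare_phase_parity_perturb[where m = m and l = l]) auto
    qed
    with True show ?thesis by (simp add: e_def)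
  qed (simp add: e_def rare_one)
  moreover have "e i \<longlonglongrightarrow> 0" for i
  proof -
    have "((\<lambda>x::nat. if i \<le> x + 2 then 31 * d x else 1) \<longlongrightarrow> 0) at_top"
    proof (rule Lim_transform_eventually)
      show "(\<lambda>x. 31 * d x) \<longlonglongrightarrow> 0" unfolding d_def by real_asymp
      show "\<forall>\<^sub>F x in sequentially. 31 * d x = (if i \<le> x + 2 then 31 * d x else 1)"
        using eventually_ge_at_top[of i] by eventually_elim simp
    qed
    from filterlim_compose[OF this k_lim] show ?thesis by (simp add: e_def[abs_def])
  qed
  moreover have "n \<le> g i n \<and> g i n \<le> (i + 2) * n" if "n \<ge> 1" for i n
    using that by (auto simp: g_def)
  ultimately obtain \<psi> where \<psi>:
      "\<And>i. i \<in> {0} \<union> Collect prime \<Longrightarrow> negligible_pred (\<lambda>n. \<psi> (g i n) \<noteq> (\<psi> n \<noteq> t i))"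
    by (rule glue_slowly_varying[where I = "{0} \<union> Collect prime"]) blast+
  show thesis
  proof (rule that)
    show "negligible_pred (\<lambda>n. \<psi> (n + 1) \<noteq> \<psi> n)"
      using \<psi>[of 0] by (simp add: g_def t_def)
    show "negligible_pred (\<lambda>n. \<psi> (p * n) \<noteq> (\<psi> n \<noteq> s p))" if "prime p" for p
      using \<psi>[of p] that by (auto simp: g_def t_def)
  qed
qed

section \<open>The twisted character modulo 3\<close>

text \<open>This is the condition that the extended character takes the value -1.\<close>

function nonresidue3 :: "nat \<Rightarrow> bool" where
  "nonresidue3 n = (if n = 0 then False else if 3 dvd n then nonresidue3 (n div 3) else n mod 3 = 2)"
  by auto
termination by (relation "Wellfounded.measure id") auto

declare nonresidue3.simps [simp del]

lemma nonresidue3_times_3 [simp]: "nonresidue3 (3 * n) = nonresidue3 n"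
  by (cases "n = 0") (simp_all add: nonresidue3.simps[of "3 * n"])

lemma nonresidue3_coprime: "\<not> 3 dvd n \<Longrightarrow> nonresidue3 n \<longleftrightarrow> n mod 3 = 2"
  by (subst nonresidue3.simps) auto

text \<open>Induction strips the factors 3 from \<open>n\<close>; the rest is multiplication of the
  residues 1 and -1 modulo 3.\<close>

lemma nonresidue3_mult:
  assumes "\<not> 3 dvd m" "n \<ge> 1"
  shows "nonresidue3 (m * n) \<longleftrightarrow> nonresidue3 n \<noteq> (m mod 3 = 2)"
  using assms(2)
proof (induction n rule: less_induct)
  case (less n)
  show ?case
  proof (cases "3 dvd n")
    case True
    then obtain k where k: "n = 3 * k" by auto
    have "nonresidue3 (m * n) = nonresidue3 (3 * (m * k))"
      by (simp add: k mult_ac)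
    also have "\<dots> = nonresidue3 (m * k)" by (rule nonresidue3_times_3)
    finally show ?thesis using less k by simp
  next
    case False
    have "prime (3 :: nat)" by simp
    with False assms(1) have "\<not> 3 dvd m * n" by (simp add: prime_dvd_mult_iff)
    moreover have "m mod 3 = 1 \<or> m mod 3 = 2" "n mod 3 = 1 \<or> n mod 3 = 2"
      using False assms(1) by presburger+
    then have "(m * n) mod 3 = 2 \<longleftrightarrow> (n mod 3 = 2) \<noteq> (m mod 3 = 2)"
      by (auto simp: mod_mult_eq[of m 3 n, symmetric])
    ultimately show ?thesis using False by (simp add: nonresidue3_coprime)
  qed
qed

text \<open>Residues 1 and 2 modulo 3 both occur, with opposite signs; the value at the multiple of
  3 is irrelevant.\<close>

lemma nonresidue3_not_constant:
  "\<not> (nonresidue3 n = nonresidue3 (n + 1) \<and> nonresidue3 n = nonresidue3 (n + 2))"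
proof -
  have c: "\<not> nonresidue3 m" if "m mod 3 = 1" for m
    using nonresidue3_coprime[of m] that by (auto simp: dvd_eq_mod_eq_0)
  have d: "nonresidue3 m" if "m mod 3 = 2" for m
    using nonresidue3_coprime[of m] that by (auto simp: dvd_eq_mod_eq_0)
  have "n mod 3 = 0 \<or> n mod 3 = 1 \<or> n mod 3 = 2" by presburger
  then show ?thesis
  proof (elim disjE)
    assume "n mod 3 = 0"
    then have "(n + 1) mod 3 = 1" "(n + 2) mod 3 = 2" by presburger+
    then show ?thesis using c d by blast
  next
    assume "n mod 3 = 1"
    moreover from this have "(n + 1) mod 3 = 2" by presburger
    ultimately show ?thesis using c d by blast
  next
    assume "n mod 3 = 2"
    moreover from this have "(n + 2) mod 3 = 1" by presburger
    ultimately show ?thesis using c d by blast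
  qed
qed

section \<open>From counts at integers to natural densities, and the density 1/2\<close>

lemma has_natural_densityI:
  assumes "(\<lambda>x. real (card {n\<in>{1..x}. P n}) / real x) \<longlonglongrightarrow> d"
  shows "has_natural_density {n. 1 \<le> n \<and> P n} d"
proof -
  define N where "N x = nat \<lfloor>x\<rfloor>" for x :: real
  have "filterlim N sequentially at_top"
    unfolding N_def by (intro filterlim_compose[OF filterlim_nat_sequentially] filterlim_floor_sequentially)
  then have "((\<lambda>x. real (card {n\<in>{1..N x}. P n}) / real (N x)) \<longlongrightarrow> d) at_top"
    by (rule filterlim_compose[OF assms])
  moreover have "((\<lambda>x. real (N x) / x) \<longlongrightarrow> 1) at_top"
    unfolding N_def by real_asymp
  ultimately have "((\<lambda>x. real (card {n\<in>{1..N x}. P n}) / real (N x) * (real (N x) / x)) \<longlongrightarrow> d * 1) at_top"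
    by (rule tendsto_mult)
  moreover have "\<forall>\<^sub>F x in at_top. real (card {n\<in>{1..N x}. P n}) / real (N x) * (real (N x) / x) =
      counting_ratio {n. 1 \<le> n \<and> P n} x"
    using eventually_ge_at_top[of 1]
  proof eventually_elim
    case (elim x)
    have "real n \<le> x \<longleftrightarrow> n \<le> N x" for n
      using elim unfolding N_def by (simp add: le_nat_floor le_nat_iff le_floor_iff)
    then have "{n. 1 \<le> n \<and> P n} \<inter> {n. 1 \<le> n \<and> real n \<le> x} = {n\<in>{1..N x}. P n}"
      by auto
    moreover have "N x > 0" using elim by (simp add: N_def)
    ultimately show ?case by (simp add: counting_ratio_def)
  qed
  ultimately show ?thesis
    unfolding has_natural_density_def by (simp add: filterlim_cong)
qed

lemma negligible_pred_imp_tendsto: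
  assumes "negligible_pred P"
  shows "(\<lambda>x. real (card {n\<in>{1..x}. P n}) / real x) \<longlonglongrightarrow> 0"
proof (rule tendstoI)
  fix e :: real assume e: "e > 0"
  then have "rare (e / 2) P" using assms by (simp add: negligible_pred_def)
  then show "\<forall>\<^sub>F x in sequentially. dist (real (card {n\<in>{1..x}. P n}) / real x) 0 < e"
    unfolding rare_def using eventually_gt_at_top[of 0]
  proof eventually_elim
    case (elim x)
    have "e / 2 * real x < e * real x" using e elim by simp
    with elim have "real (card {n\<in>{1..x}. P n}) < e * real x" by linarith
    with elim show ?case by (simp add: field_simps)
  qed
qed

text \<open>Replacing \<open>x\<close> by \<open>x div 3\<close> divides a linear bound by 3, which
  leaves room for the new errors: strong induction gives \<open>a x \<le> K + e * x\<close>, since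
  \<open>e / 2 + e / 6\<close> is below \<open>e\<close>.\<close>

lemma tendsto_zero_of_third_recursion:
  fixes a :: "nat \<Rightarrow> real"
  assumes nonneg: "\<And>x. 0 \<le> a x"
    and rec: "\<And>e. e > 0 \<Longrightarrow> \<forall>\<^sub>F y in sequentially. a (3 * y) \<le> a y + e * real y"
    and round: "\<And>x. a x \<le> a (3 * (x div 3)) + 2"
  shows "(\<lambda>x. a x / real x) \<longlonglongrightarrow> 0"
proof (rule tendstoI)
  fix \<epsilon> :: real assume \<epsilon>: "\<epsilon> > 0"
  define e where "e = \<epsilon> / 3"
  have e: "e > 0" using \<epsilon> by (simp add: e_def)
  obtain N where N: "\<And>y. y \<ge> N \<Longrightarrow> a (3 * y) \<le> a y + e / 2 * real y"
    using rec[of "e / 2"] e by (auto simp: eventually_sequentially)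
  obtain N' where N': "\<And>x. x \<ge> N' \<Longrightarrow> 2 \<le> e / 6 * real x"
  proof -
    have "\<forall>\<^sub>F x in sequentially. 2 \<le> e / 6 * real x" using e by real_asymp
    then show thesis using that by (auto simp: eventually_sequentially)
  qed
  define M where "M = 3 * N + N' + 1"
  define K where "K = (\<Sum>x<M. a x)"
  have bound: "a x \<le> K + e * real x" for x
  proof (induction x rule: less_induct)
    case (less x)
    show ?case
    proof (cases "x < M")
      case True
      then have "a x \<le> K" unfolding K_def using nonneg by (intro member_le_sum) auto
      moreover have "0 \<le> e * real x" using e by simp
      ultimately show ?thesis by linarith
    next
      case False
      define y where "y = x div 3"
      have y: "y \<ge> N" "y < x" "real y \<le> real x / 3" using False by (auto simp: y_def M_def)
      have "a x \<le> a y + e / 2 * real y + 2"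
        using round[of x] N[OF y(1)] by (simp add: y_def)
      also have "\<dots> \<le> K + e * real y + e / 2 * real y + e / 6 * real x"
        using less[OF y(2)] N'[of x] False by (simp add: M_def)
      also have "\<dots> = K + 3 / 2 * e * real y + e / 6 * real x" by simp
      also have "3 / 2 * e * real y \<le> 3 / 2 * e * (real x / 3)"
        using y(3) e by (intro mult_left_mono) auto
      also have "K + 3 / 2 * e * (real x / 3) + e / 6 * real x \<le> K + e * real x"
        using e by simp
      finally show ?thesis by simp
    qed
  qed
  have "\<forall>\<^sub>F x in sequentially. K < e * real x" using e by real_asymp
  then show "\<forall>\<^sub>F x in sequentially. dist (a x / real x) 0 < \<epsilon>"
    using eventually_gt_at_top[of 0]
  proof eventually_elim
    case (elim x)
    have "a x < \<epsilon> * real x"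
    proof -
      have "0 < e * real x" using e elim by simp
      moreover have "\<epsilon> * real x = 3 * (e * real x)" by (simp add: e_def)
      ultimately show ?thesis using bound[of x] elim(1) by linarith
    qed
    with elim nonneg[of x] show ?case by (simp add: field_simps)
  qed
qed

lemma sum_thirds:
  fixes g :: "nat \<Rightarrow> real"
  shows "(\<Sum>n=1..3*y. g n) = (\<Sum>k=1..y. g (3 * k - 2) + g (3 * k - 1) + g (3 * k))"
proof (induction y)
  case (Suc y)
  have "3 * Suc y = Suc (Suc (Suc (3 * y)))" by simp
  then have "(\<Sum>n=1..3*Suc y. g n) =
      (\<Sum>n=1..3*y. g n) + g (Suc (3 * y)) + g (Suc (Suc (3 * y))) + g (Suc (Suc (Suc (3 * y))))"
    by (simp del: mult_Suc_right)
  also have "\<dots> = (\<Sum>k=1..y. g (3 * k - 2) + g (3 * k - 1) + g (3 * k)) +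
      (g (3 * Suc y - 2) + g (3 * Suc y - 1) + g (3 * Suc y))"
  proof -
    have "3 * Suc y - 2 = Suc (3 * y)" "3 * Suc y - 1 = Suc (Suc (3 * y))"
        "3 * Suc y = Suc (Suc (Suc (3 * y)))" by simp_all
    then show ?thesis by (simp only: Suc add.assoc)
  qed
  also have "\<dots> = (\<Sum>k=1..Suc y. g (3 * k - 2) + g (3 * k - 1) + g (3 * k))"
    by simp
  finally show ?case .
qed simp

text \<open>In the sum of signs, \<open>3 * k - 2\<close> and \<open>3 * k - 1\<close> cancel when
  \<open>\<psi>\<close> agrees on them, and \<open>3 * k\<close> contributes the sign of
  \<open>k\<close>. So the sum up to \<open>3 * y\<close> is the sum up to \<open>y\<close> with an
  error o(y), and the recursion makes it o(x).\<close>

lemma half_density_of_twisted_nonresidue3: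
  fixes \<psi> :: "nat \<Rightarrow> bool"
  defines "F \<equiv> \<lambda>n. nonresidue3 n \<noteq> \<psi> n"
  assumes shift: "negligible_pred (\<lambda>n. \<psi> (n + 1) \<noteq> \<psi> n)"
    and triple: "negligible_pred (\<lambda>n. F (3 * n) \<noteq> F n)"
  shows "(\<lambda>x. real (card {n\<in>{1..x}. F n}) / real x) \<longlonglongrightarrow> 1 / 2"
proof -
  define g where "g n = (if F n then 1 else - 1 :: real)" for n
  define G where "G x = (\<Sum>n=1..x. g n)" for x
  define Q where "Q k \<longleftrightarrow> \<psi> (3 * k - 2 + 1) \<noteq> \<psi> (3 * k - 2) \<or> F (3 * k) \<noteq> F k" for k
  have "negligible_pred Q"
    unfolding Q_def
  proof (intro negligible_pred_disj triple)
    show "negligible_pred (\<lambda>k. \<psi> (3 * k - 2 + 1) \<noteq> \<psi> (3 * k - 2))"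
      by (rule negligible_pred_comp[OF shift, of "\<lambda>k. 3 * k - 2" 3]) (auto simp: inj_on_def)
  qed
  have bound: "\<bar>g (3 * k - 2) + g (3 * k - 1) + g (3 * k) - g k\<bar> \<le> 4 * of_bool (Q k)" if k: "k \<ge> 1" for k
  proof (cases "Q k")
    case True
    then show ?thesis by (simp add: g_def)
  next
    case False
    have e: "3 * k - 2 + 1 = 3 * k - 1" using k by simp
    obtain j where "k = Suc j" using k by (cases k) auto
    then have "3 * k - 2 = 1 + 3 * j" "3 * k - 1 = 2 + 3 * j" by simp_all
    then have "(3 * k - 2) mod 3 = 1" "(3 * k - 1) mod 3 = 2" by presburger+
    then have "\<not> nonresidue3 (3 * k - 2)" "nonresidue3 (3 * k - 1)"
      by (subst nonresidue3_coprime; simp add: dvd_eq_mod_eq_0)+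
    with False show ?thesis unfolding Q_def g_def F_def e by auto
  qed
  have "(\<lambda>x. \<bar>G x\<bar> / real x) \<longlonglongrightarrow> 0"
  proof (rule tendsto_zero_of_third_recursion)
    fix e :: real assume "e > 0"
    then have "rare (e / 4) Q" using \<open>negligible_pred Q\<close> by (simp add: negligible_pred_def)
    then show "\<forall>\<^sub>F y in sequentially. \<bar>G (3 * y)\<bar> \<le> \<bar>G y\<bar> + e * real y"
      unfolding rare_def
    proof eventually_elim
      case (elim y)
      have "G (3 * y) - G y = (\<Sum>k=1..y. g (3 * k - 2) + g (3 * k - 1) + g (3 * k) - g k)"
        unfolding G_def sum_thirds by (simp add: sum_subtractf)
      also have "\<bar>\<dots>\<bar> \<le> (\<Sum>k=1..y. \<bar>g (3 * k - 2) + g (3 * k - 1) + g (3 * k) - g k\<bar>)"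
        by (rule sum_abs)
      also have "\<dots> \<le> (\<Sum>k=1..y. 4 * of_bool (Q k))"
        by (intro sum_mono bound) auto
      also have "\<dots> = 4 * real (card {k\<in>{1..y}. Q k})"
        by (simp add: sum_distrib_left[symmetric] Int_def)
      finally show ?case using elim by linarith
    qed
  next
    fix x :: nat
    define y where "y = 3 * (x div 3)"
    have "x = y \<or> x = Suc y \<or> x = Suc (Suc y)" unfolding y_def by presburger
    moreover have "\<bar>g n\<bar> \<le> 1" for n by (simp add: g_def)
    ultimately show "\<bar>G x\<bar> \<le> \<bar>G (3 * (x div 3))\<bar> + 2"
      unfolding y_def[symmetric]
      by (elim disjE) (auto simp: G_def g_def)
  qed simp
  then have "(\<lambda>x. \<bar>G x / real x\<bar>) \<longlonglongrightarrow> 0"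
    by (simp add: abs_divide)
  then have "(\<lambda>x. G x / real x) \<longlonglongrightarrow> 0"
    by (rule tendsto_rabs_zero_cancel)
  then have "(\<lambda>x. 1 / 2 + G x / real x / 2) \<longlonglongrightarrow> 1 / 2 + 0 / 2"
    by (intro tendsto_intros) auto
  moreover have "\<forall>\<^sub>F x in sequentially. 1 / 2 + G x / real x / 2 = real (card {n\<in>{1..x}. F n}) / real x"
    using eventually_gt_at_top[of 0]
  proof eventually_elim
    case (elim x)
    have "G x = (\<Sum>n=1..x. 2 * of_bool (F n) - 1)"
      unfolding G_def g_def by (intro sum.cong) auto
    also have "\<dots> = 2 * real (card {n\<in>{1..x}. F n}) - real x"
      by (simp add: sum_subtractf sum_distrib_left[symmetric] Int_def)
    finally show ?case using elim by (simp add: field_simps)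
  qed
  ultimately show ?thesis
    by (simp add: filterlim_cong)
qed

section \<open>Construction of the set\<close>

theorem theorem1p6:
  shows "\<exists>S :: nat set. stable S \<and> has_natural_density S (1 / 2) \<and> lower_density S > 0 \<and>
           S \<inter> {s + 1 | s. s \<in> S} \<inter> {s + 2 | s. s \<in> S} = {}"
proof -
  obtain \<psi> where shift: "negligible_pred (\<lambda>n. \<psi> (n + 1) \<noteq> \<psi> n)"
    and mult: "\<And>p. prime p \<Longrightarrow> negligible_pred (\<lambda>n. \<psi> (p * n) \<noteq> (\<psi> n \<noteq> (p mod 3 = 2)))"
    using exists_multiplicative_sign[of "\<lambda>p. p mod 3 = 2"] by auto
  define F where "F n \<longleftrightarrow> nonresidue3 n \<noteq> \<psi> n" for n
  define D where "D n \<longleftrightarrow> F n \<and> F (n + 1) \<and> F (n + 2)" for n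
  \<comment> \<open>Only the least element of each run of three is deleted; this already destroys
    every run.\<close>
  define S where "S = {n. 1 \<le> n \<and> (F n \<and> \<not> D n)}"
  have F_mult: "negligible_pred (\<lambda>n. F (p * n) \<noteq> F n)" if p: "prime p" for p
  proof (rule negligible_pred_mono[OF mult[OF p]])
    fix n :: nat assume n: "n \<ge> 1" and ne: "F (p * n) \<noteq> F n"
    have "nonresidue3 (p * n) \<longleftrightarrow> nonresidue3 n \<noteq> (p mod 3 = 2)"
    \<comment> \<open>For 3 the prescribed sign is trivial, since \<open>3 mod 3\<close> is not 2;
      this matches the extension of the character.\<close>
    proof (cases "p = 3")
      case False
      then have "\<not> 3 dvd p" using p primes_dvd_imp_eq[of 3 p] by auto
      then show ?thesis using n by (rule nonresidue3_mult)
    qed simp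
    with ne show "\<psi> (p * n) \<noteq> (\<psi> n \<noteq> (p mod 3 = 2))" by (auto simp: F_def)
  qed
  have "negligible_pred (\<lambda>n. \<psi> (n + 1) \<noteq> \<psi> n \<or> \<psi> (n + 1 + 1) \<noteq> \<psi> (n + 1))"
    by (intro negligible_pred_disj shift
        negligible_pred_comp[OF shift, of "\<lambda>n. n + 1" 2]) (auto simp: inj_on_def)
  then have D_null: "negligible_pred D"
  proof (rule negligible_pred_mono)
    \<comment> \<open>If \<open>\<psi>\<close> were constant on the three integers,
      \<open>nonresidue3\<close> would be constant there too.\<close>
    fix n assume "D n"
    then show "\<psi> (n + 1) \<noteq> \<psi> n \<or> \<psi> (n + 1 + 1) \<noteq> \<psi> (n + 1)"
      using nonresidue3_not_constant[of n] by (auto simp: D_def F_def add.commute[of 1])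
  qed
  have "stable S"
    unfolding stable_def
  proof (intro conjI allI impI)
    show "S \<subseteq> {1..}" by (auto simp: S_def)
    fix p :: nat assume p: "prime p"
    have p0: "p > 0" using p by (rule prime_gt_0_nat)
    have "negligible_pred (\<lambda>n. F (p * n) \<noteq> F n \<or> D n \<or> D (p * n))"
      using p0 by (intro negligible_pred_disj F_mult p D_null
          negligible_pred_comp[OF D_null, of "\<lambda>n. p * n" p]) (auto simp: inj_on_def)
    then have "negligible_pred (\<lambda>n. (n \<in> S) \<noteq> (p * n \<in> S))"
      by (rule negligible_pred_mono) (use p0 in \<open>auto simp: S_def\<close>)
    then show "has_natural_density {n. 1 \<le> n \<and> (n \<in> S) \<noteq> (p * n \<in> S)} 0"
      by (intro has_natural_densityI negligible_pred_imp_tendsto)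
  qed
  moreover have density: "has_natural_density S (1 / 2)"
    unfolding S_def
  proof (rule has_natural_densityI)
    have "(\<lambda>x. real (card {n\<in>{1..x}. F n}) / real x - real (card {n\<in>{1..x}. D n}) / real x)
        \<longlonglongrightarrow> 1 / 2 - 0"
      using half_density_of_twisted_nonresidue3[OF shift] F_mult[of 3] D_null
      by (intro tendsto_diff negligible_pred_imp_tendsto) (auto simp: F_def)
    moreover have "real (card {n\<in>{1..x}. F n}) / real x - real (card {n\<in>{1..x}. D n}) / real x =
        real (card {n\<in>{1..x}. F n \<and> \<not> D n}) / real x" for x
    proof -
      have "{n\<in>{1..x}. F n} = {n\<in>{1..x}. F n \<and> \<not> D n} \<union> {n\<in>{1..x}. D n}"
        by (auto simp: D_def)
      then have "card {n\<in>{1..x}. F n} = card {n\<in>{1..x}. F n \<and> \<not> D n} + card {n\<in>{1..x}. D n}"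
        by (simp, subst card_Un_disjoint) auto
      then show ?thesis by (simp add: add_divide_distrib)
    qed
    ultimately show "(\<lambda>x. real (card {n\<in>{1..x}. F n \<and> \<not> D n}) / real x) \<longlonglongrightarrow> 1 / 2"
      by simp
  qed
  moreover have "lower_density S > 0"
  proof -
    have "((\<lambda>x. ereal (counting_ratio S x)) \<longlongrightarrow> ereal (1 / 2)) at_top"
      using density by (simp add: has_natural_density_def)
    then have "lower_density S = ereal (1 / 2)"
      unfolding lower_density_def by (intro lim_imp_Liminf) auto
    then show ?thesis by simp
  qed
  moreover have "S \<inter> {s + 1 | s. s \<in> S} \<inter> {s + 2 | s. s \<in> S} = {}"
    by (auto simp: S_def D_def)
  ultimately show ?thesis by blast
qed

end
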